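(* Let $X,Y$ be Banach spaces, $A:X\to Y$ bounded linear, $f\in Y$, and let $H_f(z)=F(z-f)$, where $F:Y\to\mathbb{R}$ is convex and Fréchet differentiable; let $R$, $u^\dagger$ and $u_\alpha$ ($\alpha>0$) be as in the context. Assume that $(F')^{-1}:Y^*\to Y$ exists, that the source condition $$\exists\,p^\dagger\in Y^*,\ v^\dagger\in X\ \text{ such that }\ A^*p^\dagger\in\partial R(u^\dagger)\ \text{ and }\ p^\dagger=-F'(-Av^\dagger)$$ holds, and that $F$ satisfies the scaling property: there exists $s:[0,+\infty)\to\mathbb{R}$ such that $\lim_{\alpha\to0}s(\alpha)=0$ and $$\forall\lambda>0,\ \forall w\in Y:\quad\lambda F'(w)=F'(s(\lambda)w).$$ Then $$D_R(u_\alpha,u^\dagger)\le D_R(u^\dagger-s(\alpha)v^\dagger,u^\dagger).$$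
   Context: $R:X\to\mathbb{R}\cup\{+\infty\}$ is proper, convex and lower semicontinuous. $u^\dagger\in\operatorname{arg\,min}\{R(u):Au=f\}$. For each $\alpha>0$ it is assumed that a minimizer $u_\alpha$ of $\frac1\alpha H_f(Au)+R(u)$ over $X$ exists, and that there is $u_0\in\operatorname{dom}(H_f\circ A)\cap\operatorname{dom}R$ such that $H_f$ is continuous at $Au_0$. $F':Y\to Y^*$ is the Fréchet derivative. $D_R(u,u^\dagger)=R(u)-R(u^\dagger)-\langle A^*p^\dagger,u-u^\dagger\rangle$ is the Bregman distance with respect to $R$ and the subgradient $A^*p^\dagger\in\partial R(u^\dagger)$. *)

theory Defs
  imports "HOL-Analysis.Analysis"
begin

text \<open>Functionals with values in the extended reals.  The value minus infinity, which
  \<open>ereal\<close> also contains, is excluded by properness.\<close>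

definition effective_domain :: "('a \<Rightarrow> ereal) \<Rightarrow> 'a set" where
  "effective_domain R = {x. R x < \<infinity>}"

definition proper_fun :: "('a \<Rightarrow> ereal) \<Rightarrow> bool" where
  "proper_fun R \<longleftrightarrow> (\<forall>x. R x \<noteq> -\<infinity>) \<and> effective_domain R \<noteq> {}"

text \<open>At the endpoints \<open>t = 0\<close> and \<open>t = 1\<close> the inequality is trivial even where \<open>R\<close> is infinite,
  because \<open>0 * \<infinity> = 0\<close> in \<open>ereal\<close>.\<close>

definition convex_fun :: "('a::real_vector \<Rightarrow> ereal) \<Rightarrow> bool" where
  "convex_fun R \<longleftrightarrow> (\<forall>x y. \<forall>t\<in>{0..1}.
     R ((1 - t) *\<^sub>R x + t *\<^sub>R y) \<le> ereal (1 - t) * R x + ereal t * R y)"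

definition lower_semicontinuous :: "('a::topological_space \<Rightarrow> ereal) \<Rightarrow> bool" where
  "lower_semicontinuous R \<longleftrightarrow> (\<forall>x. R x \<le> Liminf (at x) R)"

text \<open>The topological dual of \<open>'a\<close> is \<open>'a \<Rightarrow>\<^sub>L real\<close>; the adjoint of \<open>A\<close> is
  precomposition with \<open>A\<close>.  (The library constant \<open>adjoint\<close> is for inner product spaces.)\<close>

definition dual_adjoint ::
  "('a::real_normed_vector \<Rightarrow>\<^sub>L 'b::real_normed_vector) \<Rightarrow> ('b \<Rightarrow>\<^sub>L real) \<Rightarrow> ('a \<Rightarrow>\<^sub>L real)" where
  "dual_adjoint A p = p o\<^sub>L A"

definition subdifferential ::
  "('a::real_normed_vector \<Rightarrow> ereal) \<Rightarrow> 'a \<Rightarrow> ('a \<Rightarrow>\<^sub>L real) set" where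
  "subdifferential R x =
     {q. x \<in> effective_domain R \<and> (\<forall>y. R x + ereal (blinfun_apply q (y - x)) \<le> R y)}"

text \<open>\<open>bregman_distance R q x y\<close> is the Bregman distance \<open>D\<^sub>R(x, y)\<close> with respect to the
  subgradient \<open>q\<close> of \<open>R\<close> at the second argument \<open>y\<close>.  It is infinite if \<open>R x\<close> is; the
  subtraction of \<open>R y\<close> is harmless since \<open>R y\<close> is finite for subdifferentiable proper \<open>R\<close>.\<close>

definition bregman_distance ::
  "('a::real_normed_vector \<Rightarrow> ereal) \<Rightarrow> ('a \<Rightarrow>\<^sub>L real) \<Rightarrow> 'a \<Rightarrow> 'a \<Rightarrow> ereal" where
  "bregman_distance R q x y = R x - R y - ereal (blinfun_apply q (x - y))"

definition fidelity :: "('b::real_normed_vector \<Rightarrow> real) \<Rightarrow> 'b \<Rightarrow> 'b \<Rightarrow> real" where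
  "fidelity F f z = F (z - f)"

end

theory Submission
  imports Defs
begin

text \<open>
  Put \<open>w = - A v\<^sup>\<dagger>\<close> and \<open>v = u\<^sup>\<dagger> - s \<alpha> v\<^sup>\<dagger>\<close>.  Since \<open>A u\<^sup>\<dagger> = f\<close>, the residual of the competitor \<open>v\<close>
  is \<open>A v - f = s \<alpha> w\<close>, and the scaling property turns the source condition \<open>p\<^sup>\<dagger> = - F' w\<close> into
  \<open>F' (A v - f) = - \<alpha> p\<^sup>\<dagger>\<close>.  Hence the scaled fidelity \<open>G = (1 / \<alpha>) H\<^sub>f \<circ> A\<close> has gradient
  \<open>- A\<^sup>* p\<^sup>\<dagger>\<close> at \<open>v\<close>, and by convexity (\<open>convex_on_imp_above_derivative\<close>) this is a subgradient.
  In other words, \<open>v\<close> minimizes \<open>G + A\<^sup>* p\<^sup>\<dagger>\<close>, while \<open>u\<^sub>\<alpha>\<close> minimizes \<open>G + R\<close>; subtracting the two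
  optimality inequalities makes \<open>G\<close> cancel and shows that \<open>R - A\<^sup>* p\<^sup>\<dagger>\<close> is no larger at \<open>u\<^sub>\<alpha>\<close>
  than at \<open>v\<close> (\<open>bregman_distance_minimizer_le\<close>).  Up to a finite constant,
  \<open>R - A\<^sup>* p\<^sup>\<dagger>\<close> is the Bregman distance to \<open>u\<^sup>\<dagger>\<close>.
\<close>

text \<open>The one-dimensional tangent inequality, applied to the restriction of \<open>F\<close> to the line
  through the two points.\<close>

lemma convex_on_imp_above_derivative:
  fixes F :: "'b::real_normed_vector \<Rightarrow> real"
  assumes conv: "convex_on UNIV F"
    and deriv: "(F has_derivative D) (at x)"
  shows "F x + D (y - x) \<le> F y"
proof -
  define h where "h t = F (x + t *\<^sub>R (y - x))" for t :: real
  have "convex_on UNIV h"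
  proof (rule convex_onI)
    fix t a b :: real
    assume t: "0 < t" "t < 1"
    have "x + ((1 - t) *\<^sub>R a + t *\<^sub>R b) *\<^sub>R (y - x)
        = (1 - t) *\<^sub>R (x + a *\<^sub>R (y - x)) + t *\<^sub>R (x + b *\<^sub>R (y - x))"
      by (simp add: algebra_simps)
    then show "h ((1 - t) *\<^sub>R a + t *\<^sub>R b) \<le> (1 - t) * h a + t * h b"
      unfolding h_def using convex_onD[OF conv, of t] t by simp
  qed simp
  moreover have "(h has_real_derivative D (y - x)) (at 0)"
  proof -
    have "((\<lambda>t. x + t *\<^sub>R (y - x)) has_derivative (\<lambda>t. t *\<^sub>R (y - x))) (at 0)"
      by (auto intro!: derivative_eq_intros)
    moreover have "(F has_derivative D) (at (x + 0 *\<^sub>R (y - x)))"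
      using deriv by simp
    ultimately have "(h has_derivative (\<lambda>t. D (t *\<^sub>R (y - x)))) (at 0)"
      unfolding h_def by (rule has_derivative_compose)
    then show ?thesis
      by (simp add: has_field_derivative_def linear_cmul[OF has_derivative_linear[OF deriv]]
          mult.commute[of _ "D (y - x)"])
  qed
  ultimately have "D (y - x) * (1 - 0) \<le> h 1 - h 0"
    by (intro convex_on_imp_above_tangent[where A = UNIV]) auto
  then show ?thesis
    by (simp add: h_def)
qed

text \<open>Adding the subgradient inequality for \<open>- q\<close> at \<open>v\<close> to the optimality of \<open>x\<close> for \<open>G + R\<close>
  cancels \<open>G\<close>.  If \<open>R v\<close> is infinite, so is the right-hand side; otherwise optimality makes
  \<open>R x\<close> finite too and the cancellation takes place in the real numbers.\<close>

lemma bregman_distance_minimizer_le: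
  fixes G :: "'a::real_normed_vector \<Rightarrow> real"
  assumes proper: "proper_fun R"
    and y: "y \<in> effective_domain R"
    and min: "is_arg_min (\<lambda>z. ereal (G z) + R z) (\<lambda>_. True) x"
    and subgradient: "G v - blinfun_apply q (x - v) \<le> G x"
  shows "bregman_distance R q x y \<le> bregman_distance R q v y"
proof -
  have not_minf: "R z \<noteq> -\<infinity>" for z
    using proper by (simp add: proper_fun_def)
  obtain c where c: "R y = ereal c"
    using y not_minf[of y] by (cases "R y") (auto simp: effective_domain_def)
  have opt: "ereal (G x) + R x \<le> ereal (G v) + R v"
    using min by (auto simp: is_arg_min_def not_less)
  show ?thesis
  proof (cases "R v")
    case (real b)
    then obtain a where a: "R x = ereal a"
      using opt not_minf[of x] by (cases "R x") auto
    have "G x + a \<le> G v + b"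
      using opt a real by simp
    moreover have "blinfun_apply q (x - v)
        = blinfun_apply q (x - y) - blinfun_apply q (v - y)"
      by (simp add: blinfun.diff_right)
    ultimately show ?thesis
      using subgradient by (simp add: bregman_distance_def a real c)
  next
    case PInf
    then show ?thesis
      by (simp add: bregman_distance_def c)
  next
    case MInf
    then show ?thesis
      using not_minf[of v] by simp
  qed
qed

theorem theorem4p1:
  fixes A :: "'a::banach \<Rightarrow>\<^sub>L 'b::banach"
    and f :: 'b
    and F :: "'b \<Rightarrow> real"
    and F' :: "'b \<Rightarrow> ('b \<Rightarrow>\<^sub>L real)"
    and R :: "'a \<Rightarrow> ereal"
    and udag vdag :: 'a
    and pdag :: "'b \<Rightarrow>\<^sub>L real"
    and u :: "real \<Rightarrow> 'a"
    and s :: "real \<Rightarrow> real"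
  assumes F_convex: "convex_on UNIV F"
    and F_deriv: "\<forall>w. (F has_derivative blinfun_apply (F' w)) (at w)"
    and R_proper: "proper_fun R"
    and R_convex: "convex_fun R"
    and R_lsc: "lower_semicontinuous R"
    and udag_min: "is_arg_min R (\<lambda>x. blinfun_apply A x = f) udag"
    and u_min: "\<forall>\<alpha>>0. is_arg_min
          (\<lambda>x. ereal (1 / \<alpha> * fidelity F f (blinfun_apply A x)) + R x) (\<lambda>_. True) (u \<alpha>)"
    and qualification: "\<exists>u0 \<in> effective_domain (\<lambda>x. ereal (fidelity F f (blinfun_apply A x)))
            \<inter> effective_domain R. isCont (fidelity F f) (blinfun_apply A u0)"
    and F'_invertible: "bij F'"
    and source_subgradient: "dual_adjoint A pdag \<in> subdifferential R udag"
    and source_range: "pdag = - F' (- blinfun_apply A vdag)"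
    and s_tendsto: "(s \<longlongrightarrow> 0) (at 0 within {0..})"
    and scaling: "\<forall>\<mu>>0. \<forall>w. \<mu> *\<^sub>R F' w = F' (s \<mu> *\<^sub>R w)"
  shows "\<forall>\<alpha>>0. bregman_distance R (dual_adjoint A pdag) (u \<alpha>) udag
            \<le> bregman_distance R (dual_adjoint A pdag) (udag - s \<alpha> *\<^sub>R vdag) udag"
proof (intro allI impI)
  fix \<alpha> :: real
  assume \<alpha>: "\<alpha> > 0"
  define w where "w = - blinfun_apply A vdag"
  define v where "v = udag - s \<alpha> *\<^sub>R vdag"
  have "blinfun_apply A udag = f"
    using udag_min by (simp add: is_arg_min_def)
  then have residual: "blinfun_apply A v - f = s \<alpha> *\<^sub>R w"
    by (simp add: v_def w_def blinfun.diff_right blinfun.scaleR_right)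
  have gradient: "F' (s \<alpha> *\<^sub>R w) = - (\<alpha> *\<^sub>R pdag)"
    using scaling[rule_format, OF \<alpha>, of w, symmetric] by (simp add: source_range w_def)
  have subgradient: "1 / \<alpha> * fidelity F f (blinfun_apply A v)
        - blinfun_apply (dual_adjoint A pdag) (x - v)
      \<le> 1 / \<alpha> * fidelity F f (blinfun_apply A x)" for x
  proof -
    have "F (s \<alpha> *\<^sub>R w) + blinfun_apply (F' (s \<alpha> *\<^sub>R w)) (blinfun_apply A x - f - s \<alpha> *\<^sub>R w)
        \<le> F (blinfun_apply A x - f)"
      using F_convex F_deriv by (intro convex_on_imp_above_derivative) auto
    moreover have "blinfun_apply A x - f - s \<alpha> *\<^sub>R w = blinfun_apply A (x - v)"
      by (simp add: blinfun.diff_right flip: residual)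
    ultimately have "F (s \<alpha> *\<^sub>R w) - \<alpha> * blinfun_apply pdag (blinfun_apply A (x - v))
        \<le> F (blinfun_apply A x - f)"
      by (simp add: gradient blinfun.minus_left blinfun.scaleR_left)
    then have "(F (s \<alpha> *\<^sub>R w) - \<alpha> * blinfun_apply pdag (blinfun_apply A (x - v))) / \<alpha>
        \<le> F (blinfun_apply A x - f) / \<alpha>"
      using \<alpha> by (intro divide_right_mono) auto
    then show ?thesis
      using \<alpha> by (simp add: fidelity_def residual dual_adjoint_def diff_divide_distrib)
  qed
  have "udag \<in> effective_domain R"
    using source_subgradient by (simp add: subdifferential_def)
  then have "bregman_distance R (dual_adjoint A pdag) (u \<alpha>) udag
      \<le> bregman_distance R (dual_adjoint A pdag) v udag"
    using u_min \<alpha> subgradient R_proper by (intro bregman_distance_minimizer_le) auto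
  then show "bregman_distance R (dual_adjoint A pdag) (u \<alpha>) udag
      \<le> bregman_distance R (dual_adjoint A pdag) (udag - s \<alpha> *\<^sub>R vdag) udag"
    by (simp add: v_def)
qed

end
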